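(* There is no left-invariant Riemannian metric on $H$ whose Levi-Civita geodesics include all the affinely parametrized curves $t\mapsto T_0e^{tA}$, $T_0\in H$, $A\in\mathfrak h$. Consequently, no metric on $\Omega$ obtained by pushing forward a left-invariant Riemannian metric on $H$ through $\Phi$ has all Cholesky-Vinberg paths $\gamma^{\mathrm{cv}}_{x,y}$, $x,y\in\Omega$, as affinely parametrized Levi-Civita geodesics.
   Context: Let $V\subset \mathrm{Sym}(3,\mathbb{R})$ be the 5-dimensional space of real symmetric $3\times3$ matrices whose $(1,2)$ and $(2,1)$ entries are $0$, and let $\Omega\subset V$ be the open cone of positive definite matrices in $V$. Let $H$ be the Lie group of real lower triangular $3\times 3$ matrices with positive diagonal entries and zero $(2,1)$ entry, with Lie algebra $\mathfrak{h}$ the lower triangular $3\times3$ matrices with zero $(2,1)$ entry. The map $\Phi:H\to\Omega$, $\Phi(T)=TT^{\top}$, is a diffeomorphism; $T_x:=\Phi^{-1}(x)\in H$. For $T\in H$ and $t\in\mathbb{R}$, $T^t:=\exp(t\log T)\in H$, with the principal matrix logarithm. The Cholesky-Vinberg path is $\gamma^{\mathrm{cv}}_{x,y}(t):=\Phi\bigl(T_x(T_x^{-1}T_y)^t\bigr)$, $0\le t\le1$. *)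

theory Defs
  imports "HOL-Analysis.Analysis"
begin

section \<open>Riemannian geometry on an open subset of a linear space\<close>

text \<open>
  Below, \<open>V\<close> is a linear subspace of a Euclidean space and \<open>U\<close> a relatively open subset of \<open>V\<close>,
  regarded as a manifold with a single chart; every tangent space of \<open>U\<close> is \<open>V\<close>.
  Since \<open>U\<close> need not be open in the ambient space, derivatives are only taken in directions
  belonging to \<open>V\<close>.
\<close>

definition dir_deriv ::
  "('a::real_normed_vector \<Rightarrow> 'b::real_normed_vector) \<Rightarrow> 'a \<Rightarrow> 'a \<Rightarrow> 'b" where
  "dir_deriv f p v = vector_derivative (\<lambda>t. f (p + t *\<^sub>R v)) (at 0)"

primrec Ck_on ::
  "nat \<Rightarrow> 'a::euclidean_space set \<Rightarrow> 'a set \<Rightarrow> ('a \<Rightarrow> 'b::real_normed_vector) \<Rightarrow> bool" where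
  "Ck_on 0 V U f \<longleftrightarrow> continuous_on U f"
| "Ck_on (Suc k) V U f \<longleftrightarrow> continuous_on U f \<and>
     (\<forall>v\<in>V. (\<forall>p\<in>U. (\<lambda>t::real. f (p + t *\<^sub>R v)) differentiable (at 0)) \<and>
            Ck_on k V U (\<lambda>p. dir_deriv f p v))"

definition smooth_on ::
  "'a::euclidean_space set \<Rightarrow> 'a set \<Rightarrow> ('a \<Rightarrow> 'b::real_normed_vector) \<Rightarrow> bool" where
  "smooth_on V U f \<longleftrightarrow> (\<forall>k. Ck_on k V U f)"

definition bilinear_on ::
  "'a::real_vector set \<Rightarrow> ('a \<Rightarrow> 'a \<Rightarrow> 'b::real_vector) \<Rightarrow> bool" where
  "bilinear_on V b \<longleftrightarrow>
     (\<forall>u\<in>V. \<forall>v\<in>V. \<forall>w\<in>V. b (u + v) w = b u w + b v w \<and> b w (u + v) = b w u + b w v) \<and>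
     (\<forall>c. \<forall>u\<in>V. \<forall>v\<in>V. b (c *\<^sub>R u) v = c *\<^sub>R b u v \<and> b u (c *\<^sub>R v) = c *\<^sub>R b u v)"

definition riemannian_metric ::
  "'a::euclidean_space set \<Rightarrow> 'a set \<Rightarrow> ('a \<Rightarrow> 'a \<Rightarrow> 'a \<Rightarrow> real) \<Rightarrow> bool" where
  "riemannian_metric V U g \<longleftrightarrow>
     (\<forall>p\<in>U. bilinear_on V (g p) \<and> (\<forall>u\<in>V. \<forall>v\<in>V. g p u v = g p v u) \<and>
            (\<forall>u\<in>V. u \<noteq> 0 \<longrightarrow> 0 < g p u u)) \<and>
     (\<forall>u\<in>V. \<forall>v\<in>V. smooth_on V U (\<lambda>p. g p u v))"

definition vector_fields :: "'a::euclidean_space set \<Rightarrow> 'a set \<Rightarrow> ('a \<Rightarrow> 'a) set" where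
  "vector_fields V U = {X. (\<forall>p\<in>U. X p \<in> V) \<and> smooth_on V U X}"

definition lie_bracket ::
  "('a::euclidean_space \<Rightarrow> 'a) \<Rightarrow> ('a \<Rightarrow> 'a) \<Rightarrow> 'a \<Rightarrow> 'a" where
  "lie_bracket X Y p = dir_deriv Y p (X p) - dir_deriv X p (Y p)"

text \<open>
  In the global chart every affine connection is the flat one plus a smooth field \<open>G\<close> of bilinear
  maps (the Christoffel symbols, in coordinate-free form).
\<close>

definition christoffel_field ::
  "'a::euclidean_space set \<Rightarrow> 'a set \<Rightarrow> ('a \<Rightarrow> 'a \<Rightarrow> 'a \<Rightarrow> 'a) \<Rightarrow> bool" where
  "christoffel_field V U G \<longleftrightarrow>
     (\<forall>p\<in>U. bilinear_on V (G p) \<and> (\<forall>u\<in>V. \<forall>v\<in>V. G p u v \<in> V)) \<and>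
     (\<forall>u\<in>V. \<forall>v\<in>V. smooth_on V U (\<lambda>p. G p u v))"

definition cov_deriv ::
  "('a::euclidean_space \<Rightarrow> 'a \<Rightarrow> 'a \<Rightarrow> 'a) \<Rightarrow> ('a \<Rightarrow> 'a) \<Rightarrow> ('a \<Rightarrow> 'a) \<Rightarrow> 'a \<Rightarrow> 'a" where
  "cov_deriv G X Y p = dir_deriv Y p (X p) + G p (X p) (Y p)"

definition torsion_free ::
  "'a::euclidean_space set \<Rightarrow> 'a set \<Rightarrow> ('a \<Rightarrow> 'a \<Rightarrow> 'a \<Rightarrow> 'a) \<Rightarrow> bool" where
  "torsion_free V U G \<longleftrightarrow>
     (\<forall>X\<in>vector_fields V U. \<forall>Y\<in>vector_fields V U. \<forall>p\<in>U.
        cov_deriv G X Y p - cov_deriv G Y X p = lie_bracket X Y p)"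

definition metric_compatible ::
  "'a::euclidean_space set \<Rightarrow> 'a set \<Rightarrow> ('a \<Rightarrow> 'a \<Rightarrow> 'a \<Rightarrow> real) \<Rightarrow>
     ('a \<Rightarrow> 'a \<Rightarrow> 'a \<Rightarrow> 'a) \<Rightarrow> bool" where
  "metric_compatible V U g G \<longleftrightarrow>
     (\<forall>X\<in>vector_fields V U. \<forall>Y\<in>vector_fields V U. \<forall>Z\<in>vector_fields V U. \<forall>p\<in>U.
        dir_deriv (\<lambda>q. g q (Y q) (Z q)) p (X p) =
          g p (cov_deriv G X Y p) (Z p) + g p (Y p) (cov_deriv G X Z p))"

definition levi_civita ::
  "'a::euclidean_space set \<Rightarrow> 'a set \<Rightarrow> ('a \<Rightarrow> 'a \<Rightarrow> 'a \<Rightarrow> real) \<Rightarrow>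
     ('a \<Rightarrow> 'a \<Rightarrow> 'a \<Rightarrow> 'a) \<Rightarrow> bool" where
  "levi_civita V U g G \<longleftrightarrow>
     christoffel_field V U G \<and> torsion_free V U G \<and> metric_compatible V U g G"

text \<open>
  Affinely parametrized geodesics of the Levi-Civita connection on a real interval \<open>I\<close>. By the
  fundamental theorem of Riemannian geometry \<open>G\<close> exists and is unique (on \<open>U\<close> and \<open>V\<close>), so the
  existential quantifier merely names it. At endpoints of \<open>I\<close> derivatives are one-sided.
\<close>

definition geodesic_on ::
  "'a::euclidean_space set \<Rightarrow> 'a set \<Rightarrow> ('a \<Rightarrow> 'a \<Rightarrow> 'a \<Rightarrow> real) \<Rightarrow>
     real set \<Rightarrow> (real \<Rightarrow> 'a) \<Rightarrow> bool" where
  "geodesic_on V U g I c \<longleftrightarrow>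
     (\<exists>G. levi_civita V U g G \<and>
       (\<exists>c' c''. \<forall>t\<in>I. c t \<in> U \<and>
          (c has_vector_derivative c' t) (at t within I) \<and>
          (c' has_vector_derivative c'' t) (at t within I) \<and>
          c'' t + G (c t) (c' t) (c' t) = 0))"

section \<open>Exponential, principal logarithm and real powers of matrices\<close>

primrec mat_power :: "real^'n^'n \<Rightarrow> nat \<Rightarrow> real^'n^'n" where
  "mat_power A 0 = mat 1"
| "mat_power A (Suc k) = A ** mat_power A k"

definition mat_exp :: "real^'n^'n \<Rightarrow> real^'n^'n" where
  "mat_exp A = (\<Sum>k. (1 / fact k) *\<^sub>R mat_power A k)"

definition complex_eigenvalue :: "real^'n^'n \<Rightarrow> complex \<Rightarrow> bool" where
  "complex_eigenvalue A z \<longleftrightarrow>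
     (\<exists>v::complex^'n. v \<noteq> 0 \<and> (\<chi> i j. complex_of_real (A $ i $ j)) *v v = z *s v)"

text \<open>
  The principal logarithm of a matrix without eigenvalues in \<open>(-\<infinity>, 0]\<close>: its unique logarithm all
  of whose eigenvalues have imaginary part strictly between \<open>-\<pi>\<close> and \<open>\<pi>\<close>. For a real matrix it is real.
\<close>

definition mat_log :: "real^'n^'n \<Rightarrow> real^'n^'n" where
  "mat_log A = (THE L. mat_exp L = A \<and> (\<forall>z. complex_eigenvalue L z \<longrightarrow> - pi < Im z \<and> Im z < pi))"

definition mat_rpow :: "real^'n^'n \<Rightarrow> real \<Rightarrow> real^'n^'n" where
  "mat_rpow A t = mat_exp (t *\<^sub>R mat_log A)"

section \<open>The cone, the triangular group and the Cholesky-Vinberg paths\<close>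

text \<open>
  Entries are listed explicitly because in the index type \<open>3\<close> the numeral \<open>3\<close> equals \<open>0\<close>, so the
  order of the indices is not the usual one.
\<close>

definition sym_space :: "(real^3^3) set" where
  "sym_space = {x. transpose x = x \<and> x $ 1 $ 2 = 0 \<and> x $ 2 $ 1 = 0}"

definition pd_cone :: "(real^3^3) set" where
  "pd_cone = {x \<in> sym_space. \<forall>v::real^3. v \<noteq> 0 \<longrightarrow> 0 < v \<bullet> (x *v v)}"

definition tri_algebra :: "(real^3^3) set" where
  "tri_algebra = {A. A $ 1 $ 2 = 0 \<and> A $ 1 $ 3 = 0 \<and> A $ 2 $ 3 = 0 \<and> A $ 2 $ 1 = 0}"

definition tri_group :: "(real^3^3) set" where
  "tri_group = {T \<in> tri_algebra. 0 < T $ 1 $ 1 \<and> 0 < T $ 2 $ 2 \<and> 0 < T $ 3 $ 3}"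

definition chol_map :: "real^3^3 \<Rightarrow> real^3^3" where
  "chol_map T = T ** transpose T"

definition chol_factor :: "real^3^3 \<Rightarrow> real^3^3" where
  "chol_factor = inv_into tri_group chol_map"

definition cholesky_vinberg_path :: "real^3^3 \<Rightarrow> real^3^3 \<Rightarrow> real \<Rightarrow> real^3^3" where
  "cholesky_vinberg_path x y t =
     chol_map (chol_factor x ** mat_rpow (matrix_inv (chol_factor x) ** chol_factor y) t)"

text \<open>Left translation by \<open>S\<close> is the restriction of a linear map, hence is its own differential.\<close>

definition left_invariant_metric :: "(real^3^3 \<Rightarrow> real^3^3 \<Rightarrow> real^3^3 \<Rightarrow> real) \<Rightarrow> bool" where
  "left_invariant_metric g \<longleftrightarrow>
     riemannian_metric tri_algebra tri_group g \<and>
     (\<forall>S\<in>tri_group. \<forall>T\<in>tri_group. \<forall>u\<in>tri_algebra. \<forall>v\<in>tri_algebra.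
        g (S ** T) (S ** u) (S ** v) = g T u v)"

text \<open>The push-forward through the diffeomorphism \<open>chol_map\<close>: the pull-back along its inverse.\<close>

definition chol_push_metric ::
  "(real^3^3 \<Rightarrow> real^3^3 \<Rightarrow> real^3^3 \<Rightarrow> real) \<Rightarrow> real^3^3 \<Rightarrow> real^3^3 \<Rightarrow> real^3^3 \<Rightarrow> real" where
  "chol_push_metric g x u v =
     g (chol_factor x) (dir_deriv chol_factor x u) (dir_deriv chol_factor x v)"

end

theory Submission
  imports Defs
begin

text \<open>
  For a left-invariant metric \<open>g\<close> on \<open>H\<close>, the Koszul formula shows that \<open>t \<mapsto> exp (t A)\<close> can be a
  geodesic only if \<open>g(A, [A, Z]) = 0\<close> at the identity for all \<open>Z\<close>. The unipotent curve with
  \<open>A = E\<^sub>3\<^sub>1\<close>, tested against \<open>Z = E\<^sub>1\<^sub>1\<close>, already contradicts this, since \<open>[A, Z] = A\<close>. Its image in the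
  cone is the Cholesky-Vinberg path from \<open>I\<close> to \<open>\<Phi>(I + E\<^sub>3\<^sub>1)\<close>. In both charts the Koszul formula is
  evaluated with constant vector fields, so only the variation of the metric along two lines
  through \<open>I\<close> enters. That the same curve serves on the cone needs \<open>log (I + E\<^sub>3\<^sub>1) = E\<^sub>3\<^sub>1\<close>.
\<close>

section \<open>Levi-Civita connections and geodesics in a linear chart\<close>

lemma Ck_on_const: "Ck_on k V U (\<lambda>p. c)"
  by (induction k arbitrary: c) (simp_all add: dir_deriv_def)

lemma const_vector_field: "v \<in> V \<Longrightarrow> (\<lambda>p. v) \<in> vector_fields V U"
  by (simp add: vector_fields_def smooth_on_def Ck_on_const)

lemma dir_deriv_const [simp]: "dir_deriv (\<lambda>p. c) p v = 0"
  by (simp add: dir_deriv_def)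

text \<open>Constant fields have zero bracket, so torsion-freeness reduces to symmetry of
  \<open>G p\<close> in \<open>u\<close> and \<open>w\<close>. Differentiating
  \<open>g q u u\<close> along \<open>w\<close> then gives twice the term that must be removed from
  the derivative of \<open>g q u w\<close> along \<open>u\<close>. Symmetry is asked of
  \<open>g\<close> only at \<open>p\<close>, which for the push-forward metric is easy to
  supply.\<close>

lemma levi_civita_koszul:
  assumes lc: "levi_civita V U g G" and p: "p \<in> U" and u: "u \<in> V" and w: "w \<in> V"
    and sym: "\<And>a b. a \<in> V \<Longrightarrow> b \<in> V \<Longrightarrow> g p a b = g p b a"
  shows "g p (G p u u) w = dir_deriv (\<lambda>q. g q u w) p u - dir_deriv (\<lambda>q. g q u u) p w / 2"
proof -
  note uf = const_vector_field [OF u, of U] and wf = const_vector_field [OF w, of U]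
  have mc: "\<And>X Y Z. X \<in> vector_fields V U \<Longrightarrow> Y \<in> vector_fields V U \<Longrightarrow> Z \<in> vector_fields V U \<Longrightarrow>
      dir_deriv (\<lambda>q. g q (Y q) (Z q)) p (X p) =
        g p (cov_deriv G X Y p) (Z p) + g p (Y p) (cov_deriv G X Z p)"
    using lc p unfolding levi_civita_def metric_compatible_def by blast
  have "cov_deriv G (\<lambda>p. u) (\<lambda>p. w) p - cov_deriv G (\<lambda>p. w) (\<lambda>p. u) p = lie_bracket (\<lambda>p. u) (\<lambda>p. w) p"
    using lc p uf wf unfolding levi_civita_def torsion_free_def by blast
  then have G: "G p w u = G p u w"
    by (simp add: cov_deriv_def lie_bracket_def)
  have GV: "G p u w \<in> V"
    using lc p u w unfolding levi_civita_def christoffel_field_def by blast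
  have "dir_deriv (\<lambda>q. g q u w) p u = g p (G p u u) w + g p u (G p u w)"
    using mc [OF uf uf wf] by (simp add: cov_deriv_def)
  moreover have "dir_deriv (\<lambda>q. g q u u) p w = g p (G p u w) u + g p u (G p u w)"
    using mc [OF wf uf uf] by (simp add: cov_deriv_def G)
  ultimately show ?thesis
    using sym [OF GV u] by simp
qed

lemma geodesic_on_subset:
  assumes "geodesic_on V U g I c" "J \<subseteq> I"
  shows "geodesic_on V U g J c"
  using assms unfolding geodesic_on_def
  by (meson has_vector_derivative_within_subset subsetD)

lemma geodesic_on_cong:
  assumes "geodesic_on V U g I c" "\<And>t. t \<in> I \<Longrightarrow> c t = d t"
  shows "geodesic_on V U g I d"
proof -
  obtain G c' c'' where G: "levi_civita V U g G" and
    c: "\<forall>t\<in>I. c t \<in> U \<and> (c has_vector_derivative c' t) (at t within I) \<and>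
          (c' has_vector_derivative c'' t) (at t within I) \<and> c'' t + G (c t) (c' t) (c' t) = 0"
    using assms(1) unfolding geodesic_on_def by auto
  have "\<forall>t\<in>I. d t \<in> U \<and> (d has_vector_derivative c' t) (at t within I) \<and>
          (c' has_vector_derivative c'' t) (at t within I) \<and> c'' t + G (d t) (c' t) (c' t) = 0"
    using c assms(2) by (metis has_vector_derivative_transform)
  then show ?thesis
    using G unfolding geodesic_on_def by blast
qed

text \<open>Both test curves are polynomials of degree at most 2 in their charts, so the geodesic
  equation at t = 0 gives the Christoffel term in the direction \<open>u\<close> directly as minus
  the constant acceleration.\<close>

lemma quadratic_geodesic:
  assumes geo: "geodesic_on V U g {0..1} (\<lambda>t. p + t *\<^sub>R u + t\<^sup>2 *\<^sub>R e)"
  obtains G where "levi_civita V U g G" "p \<in> U" "G p u u = - 2 *\<^sub>R e"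
proof -
  let ?c = "\<lambda>t::real. p + t *\<^sub>R u + t\<^sup>2 *\<^sub>R e"
  obtain G c' c'' where G: "levi_civita V U g G" and
    c: "\<And>t. t \<in> {0..1} \<Longrightarrow> ?c t \<in> U"
       "\<And>t. t \<in> {0..1} \<Longrightarrow> (?c has_vector_derivative c' t) (at t within {0..1})"
       "\<And>t. t \<in> {0..1} \<Longrightarrow> (c' has_vector_derivative c'' t) (at t within {0..1})"
       "\<And>t. t \<in> {0..1} \<Longrightarrow> c'' t + G (?c t) (c' t) (c' t) = 0"
    using geo unfolding geodesic_on_def by blast
  \<comment> \<open>The velocity is identified on all of [0,1], not only at 0, because it is
    differentiated again at 0. Derivatives within a nondegenerate closed interval are unique, also
    the one-sided ones.\<close>
  have c': "c' t = u + (2 * t) *\<^sub>R e" if t: "t \<in> {0..1}" for t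
  proof -
    have "(?c has_vector_derivative u + (2 * t) *\<^sub>R e) (at t within {0..1})"
      by (auto intro!: derivative_eq_intros)
    then show ?thesis
      using c(2) [OF t] t vector_derivative_unique_within_closed_interval
      by (metis atLeastAtMost_iff box_real(2) zero_less_one)
  qed
  have "((\<lambda>t. u + (2 * t) *\<^sub>R e) has_vector_derivative 2 *\<^sub>R e) (at 0 within {0..1})"
    by (auto intro!: derivative_eq_intros)
  moreover have "((\<lambda>t. u + (2 * t) *\<^sub>R e) has_vector_derivative c'' 0) (at 0 within {0..1})"
    using has_vector_derivative_transform [OF _ _ c(3) [of 0]] c' by simp
  ultimately have "c'' 0 = 2 *\<^sub>R e"
    by (metis atLeastAtMost_iff box_real(2) order_refl vector_derivative_unique_within_closed_interval zero_less_one zero_le_one)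
  moreover have "c'' 0 + G p u u = 0" "p \<in> U"
    using c(1,4) [of 0] c' [of 0] by auto
  ultimately show thesis
    using that G by (simp add: add_eq_0_iff)
qed

section \<open>The matrix exponential series\<close>

lemma bounded_bilinear_matrix_mult:
  "bounded_bilinear ((**) :: real^'n^'n \<Rightarrow> real^'n^'n \<Rightarrow> real^'n^'n)"
  unfolding bilinear_conv_bounded_bilinear [symmetric] bilinear_def
  by (auto intro!: linearI simp: vec_eq_iff matrix_matrix_mult_def sum.distrib sum_distrib_left
      algebra_simps)

text \<open>The norm on matrices is submultiplicative up to a constant \<open>K\<close>, so the
  series is dominated by a multiple of the scalar exponential series at
  \<open>norm A * K\<close>.\<close>

lemma summable_mat_exp:
  fixes A :: "real^'n^'n"
  shows "summable (\<lambda>k. (1 / fact k) *\<^sub>R mat_power A k)"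
proof -
  obtain K where K: "\<forall>(A::real^'n^'n) (B::real^'n^'n). norm (A ** B) \<le> norm A * norm B * K" "0 < K"
    using bounded_bilinear.pos_bounded [OF bounded_bilinear_matrix_mult] by auto
  let ?r = "norm A * K"
  have P: "norm (mat_power A k) \<le> norm (mat 1 :: real^'n^'n) * ?r ^ k" for k
  proof (induction k)
    case (Suc k)
    have "norm (mat_power A (Suc k)) \<le> ?r * norm (mat_power A k)"
      using K(1) [rule_format, of A "mat_power A k"] by (simp add: mult_ac)
    also have "\<dots> \<le> ?r * (norm (mat 1 :: real^'n^'n) * ?r ^ k)"
      using Suc K(2) by (intro mult_left_mono) auto
    finally show ?case
      by (simp add: mult_ac)
  qed simp
  have "summable (\<lambda>k. norm (mat 1 :: real^'n^'n) * (inverse (fact k) * ?r ^ k))"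
    by (intro summable_mult summable_exp)
  then show ?thesis
    by (rule summable_comparison_test') (use P in \<open>simp add: field_simps\<close>)
qed

lemma mat_power_commute: "A ** mat_power A k = mat_power A k ** A"
proof (induction k)
  case (Suc k)
  then show ?case
    by (metis mat_power.simps(2) matrix_mul_assoc)
qed simp

text \<open>Multiplication by \<open>A\<close> on either side is continuous and passes through the
  series term by term. This yields linear equations for the entries of an unknown logarithm.\<close>

lemma mat_exp_commute: "A ** mat_exp A = mat_exp A ** A"
  for A :: "real^'n^'n"
proof -
  interpret bounded_bilinear "(**) :: real^'n^'n \<Rightarrow> real^'n^'n \<Rightarrow> real^'n^'n"
    by (rule bounded_bilinear_matrix_mult)
  show ?thesis
    unfolding mat_exp_def
    using bounded_linear.suminf [OF bounded_linear_left summable_mat_exp, of A A]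
      bounded_linear.suminf [OF bounded_linear_right summable_mat_exp, of A A]
    by (simp add: scaleR_left scaleR_right mat_power_commute)
qed

lemma mat_exp_nth:
  "mat_exp A $ i $ j = (\<Sum>k. mat_power A k $ i $ j / fact k)" for A :: "real^'n^'n"
proof -
  have "bounded_linear (\<lambda>M::real^'n^'n. M $ i $ j)"
    by (intro bounded_linear_compose [OF bounded_linear_vec_nth] bounded_linear_vec_nth)
  from bounded_linear.suminf [OF this summable_mat_exp, of A] show ?thesis
    by (simp add: mat_exp_def)
qed

lemma mat_exp_nilpotent:
  fixes A :: "real^'n^'n"
  assumes "A ** (A ** A) = 0"
  shows "mat_exp A = mat 1 + A + (1/2) *\<^sub>R (A ** A)"
proof -
  have *: "mat_power A (k + 3) = 0" for k
    by (induction k) (simp_all add: assms eval_nat_numeral)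
  have "(1 / fact k) *\<^sub>R mat_power A k = 0" if "k \<notin> {..<3}" for k
    using * [of "k - 3"] that by simp
  then have "mat_exp A = (\<Sum>k<3. (1 / fact k) *\<^sub>R mat_power A k)"
    unfolding mat_exp_def by (intro suminf_finite) auto
  then show ?thesis
    by (simp add: eval_nat_numeral)
qed

section \<open>Coordinates on the triangular algebra and the symmetric space\<close>

definition lower :: "real \<Rightarrow> real \<Rightarrow> real \<Rightarrow> real \<Rightarrow> real \<Rightarrow> real^3^3" where
  "lower a b c p q = vector [vector [a, 0, 0], vector [0, b, 0], vector [p, q, c]]"

definition symm :: "real \<Rightarrow> real \<Rightarrow> real \<Rightarrow> real \<Rightarrow> real \<Rightarrow> real^3^3" where
  "symm a b c p q = vector [vector [a, 0, p], vector [0, b, q], vector [p, q, c]]"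

lemma lower_nth [simp]:
  "lower a b c p q $ 1 $ 1 = a" "lower a b c p q $ 1 $ 2 = 0" "lower a b c p q $ 1 $ 3 = 0"
  "lower a b c p q $ 2 $ 1 = 0" "lower a b c p q $ 2 $ 2 = b" "lower a b c p q $ 2 $ 3 = 0"
  "lower a b c p q $ 3 $ 1 = p" "lower a b c p q $ 3 $ 2 = q" "lower a b c p q $ 3 $ 3 = c"
  by (simp_all add: lower_def)

lemma symm_nth [simp]:
  "symm a b c p q $ 1 $ 1 = a" "symm a b c p q $ 1 $ 2 = 0" "symm a b c p q $ 1 $ 3 = p"
  "symm a b c p q $ 2 $ 1 = 0" "symm a b c p q $ 2 $ 2 = b" "symm a b c p q $ 2 $ 3 = q"
  "symm a b c p q $ 3 $ 1 = p" "symm a b c p q $ 3 $ 2 = q" "symm a b c p q $ 3 $ 3 = c"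
  by (simp_all add: symm_def)

lemma mat_1_nth [simp]:
  "(mat 1 :: real^3^3) $ 1 $ 1 = 1" "(mat 1 :: real^3^3) $ 1 $ 2 = 0" "(mat 1 :: real^3^3) $ 1 $ 3 = 0"
  "(mat 1 :: real^3^3) $ 2 $ 1 = 0" "(mat 1 :: real^3^3) $ 2 $ 2 = 1" "(mat 1 :: real^3^3) $ 2 $ 3 = 0"
  "(mat 1 :: real^3^3) $ 3 $ 1 = 0" "(mat 1 :: real^3^3) $ 3 $ 2 = 0" "(mat 1 :: real^3^3) $ 3 $ 3 = 1"
  by (simp_all add: mat_def)

lemma matrix_mult_3: "((A::real^3^3) ** B) $ i $ j = A$i$1 * B$1$j + A$i$2 * B$2$j + A$i$3 * B$3$j"
  by (simp add: matrix_matrix_mult_def sum_3)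

lemma lower_mult:
  "lower a b c p q ** lower a' b' c' p' q' =
     lower (a * a') (b * b') (c * c') (p * a' + c * p') (q * b' + c * q')"
  by (simp add: vec_eq_iff forall_3 matrix_mult_3)

lemma lower_add:
  "lower a b c p q + lower a' b' c' p' q' = lower (a + a') (b + b') (c + c') (p + p') (q + q')"
  by (simp add: vec_eq_iff forall_3)

lemma lower_scale: "r *\<^sub>R lower a b c p q = lower (r * a) (r * b) (r * c) (r * p) (r * q)"
  by (simp add: vec_eq_iff forall_3)

lemma lower_zero [simp]: "lower 0 0 0 0 0 = 0"
  by (simp add: vec_eq_iff forall_3)

lemma symm_add:
  "symm a b c p q + symm a' b' c' p' q' = symm (a + a') (b + b') (c + c') (p + p') (q + q')"
  by (simp add: vec_eq_iff forall_3)

lemma symm_scale: "r *\<^sub>R symm a b c p q = symm (r * a) (r * b) (r * c) (r * p) (r * q)"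
  by (simp add: vec_eq_iff forall_3)

lemma lower_in_algebra [simp]: "lower a b c p q \<in> tri_algebra"
  by (simp add: tri_algebra_def)

lemma symm_in_space [simp]: "symm a b c p q \<in> sym_space"
  by (simp add: sym_space_def vec_eq_iff forall_3 transpose_def)

lemma lower_in_group [simp]: "lower a b c p q \<in> tri_group \<longleftrightarrow> 0 < a \<and> 0 < b \<and> 0 < c"
  by (simp add: tri_group_def)

lemma tri_group_cases:
  assumes "T \<in> tri_group"
  obtains a b c p q where "T = lower a b c p q" "0 < a" "0 < b" "0 < c"
proof
  show "T = lower (T$1$1) (T$2$2) (T$3$3) (T$3$1) (T$3$2)"
    using assms by (simp add: tri_group_def tri_algebra_def vec_eq_iff forall_3)
qed (use assms in \<open>simp_all add: tri_group_def\<close>)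

lemma mat_1_lower: "mat 1 = lower 1 1 1 0 0"
  by (simp add: vec_eq_iff forall_3)

section \<open>The Cholesky factorisation in coordinates\<close>

lemma chol_map_lower:
  "chol_map (lower a b c p q) = symm (a\<^sup>2) (b\<^sup>2) (c\<^sup>2 + p\<^sup>2 + q\<^sup>2) (a * p) (b * q)"
  by (simp add: chol_map_def vec_eq_iff forall_3 matrix_mult_3 transpose_def power2_eq_square)

text \<open>Positivity of the diagonal recovers \<open>a\<close> and \<open>b\<close> from their
  squares, then \<open>p\<close> and \<open>q\<close> by cancellation, and finally \<open>c\<close>
  from the (3,3) entry.\<close>

lemma inj_on_chol_map: "inj_on chol_map tri_group"
proof (rule inj_onI)
  fix S T assume S: "S \<in> tri_group" and T: "T \<in> tri_group" and eq: "chol_map S = chol_map T"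
  obtain a b c p q where S: "S = lower a b c p q" "0 < a" "0 < b" "0 < c"
    using S by (rule tri_group_cases)
  obtain a' b' c' p' q' where T: "T = lower a' b' c' p' q'" "0 < a'" "0 < b'" "0 < c'"
    using T by (rule tri_group_cases)
  have e: "a\<^sup>2 = a'\<^sup>2" "b\<^sup>2 = b'\<^sup>2" "a * p = a' * p'" "b * q = b' * q'"
      "c\<^sup>2 + p\<^sup>2 + q\<^sup>2 = c'\<^sup>2 + p'\<^sup>2 + q'\<^sup>2"
    using eq unfolding S(1) T(1) chol_map_lower by (metis symm_nth)+
  have "a = a'" "b = b'"
    using e(1,2) S T by (simp_all add: power2_eq_iff_nonneg)
  moreover from this have "p = p'" "q = q'"
    using e(3,4) S T by simp_all
  ultimately show "S = T"
    using e(5) S T by (simp add: power2_eq_iff_nonneg)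
qed

text \<open>The quantity \<open>c - p\<^sup>2 / a - q\<^sup>2 / b\<close> is the Schur complement of
  the diagonal block with entries \<open>a\<close> and \<open>b\<close>. The displayed matrix is a
  preimage, and injectivity makes it the one that \<open>inv_into\<close> selects.\<close>

lemma chol_factor_symm:
  assumes "0 < a" "0 < b" "0 < c - p\<^sup>2 / a - q\<^sup>2 / b"
  shows "chol_factor (symm a b c p q) =
    lower (sqrt a) (sqrt b) (sqrt (c - p\<^sup>2 / a - q\<^sup>2 / b)) (p / sqrt a) (q / sqrt b)"
proof -
  let ?T = "lower (sqrt a) (sqrt b) (sqrt (c - p\<^sup>2 / a - q\<^sup>2 / b)) (p / sqrt a) (q / sqrt b)"
  have "chol_map ?T = symm a b c p q"
    using assms by (simp add: chol_map_lower power_divide)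
  moreover have "?T \<in> tri_group"
    using assms by simp
  ultimately show ?thesis
    unfolding chol_factor_def by (metis inv_into_f_f inj_on_chol_map)
qed

lemma chol_map_in_pd_cone:
  assumes "T \<in> tri_group"
  shows "chol_map T \<in> pd_cone"
proof -
  obtain a b c p q where T: "T = lower a b c p q" "0 < a" "0 < b" "0 < c"
    using assms by (rule tri_group_cases)
  have "0 < v \<bullet> (chol_map T *v v)" if "v \<noteq> 0" for v
  proof -
    have *: "v \<bullet> (chol_map T *v v) = (v v* T) \<bullet> (v v* T)"
      by (simp add: chol_map_def dot_lmul_matrix flip: matrix_vector_mul_assoc)
    \<comment> \<open>The positive diagonal of \<open>T\<close> allows elimination: the third
      coordinate of \<open>v v* T\<close> forces \<open>v $ 3 = 0\<close>, and the other two then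
      force the rest of \<open>v\<close> to vanish.\<close>
    have "v v* T \<noteq> 0"
      using that T by (auto simp: vec_eq_iff forall_3 vector_matrix_mult_def sum_3)
    then show ?thesis
      by (simp add: *)
  qed
  then show ?thesis
    by (simp add: pd_cone_def T chol_map_lower)
qed

section \<open>Exponential and logarithm of the unipotent element\<close>

lemma mat_exp_unipotent: "mat_exp (t *\<^sub>R lower 0 0 0 1 0) = lower 1 1 1 t 0"
  by (subst mat_exp_nilpotent)
     (simp_all add: lower_scale lower_mult lower_add mat_1_lower)

text \<open>Since \<open>mat_log\<close> is a definite description, two facts are needed: the
  nilpotent candidate, whose only eigenvalue is 0, qualifies, and no other real matrix does.\<close>

lemma mat_log_unipotent: "mat_log (lower 1 1 1 1 0) = lower 0 0 0 1 0"
  unfolding mat_log_def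
proof (rule the_equality)
  have *: "z = 0" if eig: "complex_eigenvalue (lower 0 0 0 1 0) z" for z
  proof -
    obtain v :: "complex^3" where v: "v \<noteq> 0"
      "(\<chi> i j. complex_of_real (lower 0 0 0 1 0 $ i $ j)) *v v = z *s v"
      using eig unfolding complex_eigenvalue_def by (elim exE conjE) (rule that)
    have e: "((\<chi> i j. complex_of_real (lower 0 0 0 1 0 $ i $ j)) *v v) $ k = z * v $ k" for k
      by (simp only: v(2) vector_smult_component)
    have "z * v $ 1 = 0"
      using e [of 1] by (simp add: matrix_vector_mult_def sum_3)
    moreover have "z * v $ 2 = 0"
      using e [of 2] by (simp add: matrix_vector_mult_def sum_3)
    moreover have "v $ 1 = z * v $ 3"
      using e [of 3] by (simp add: matrix_vector_mult_def sum_3)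
    ultimately show "z = 0"
      using v(1) by (auto simp: vec_eq_iff forall_3)
  qed
  show "mat_exp (lower 0 0 0 1 0) = lower 1 1 1 1 0 \<and>
      (\<forall>z. complex_eigenvalue (lower 0 0 0 1 0) z \<longrightarrow> - pi < Im z \<and> Im z < pi)"
    using mat_exp_unipotent [of 1] by (auto dest!: *)
next
  fix L :: "real^3^3"
  assume "mat_exp L = lower 1 1 1 1 0 \<and> (\<forall>z. complex_eigenvalue L z \<longrightarrow> - pi < Im z \<and> Im z < pi)"
  then have L: "mat_exp L = lower 1 1 1 1 0" ..
  txt \<open>Commuting with its exponential forces \<open>L\<close> to be lower triangular, and comparing diagonals
    then makes it strictly lower triangular.\<close>
  have comm: "(L ** lower 1 1 1 1 0) $ i $ j = (lower 1 1 1 1 0 ** L) $ i $ j" for i j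
    using mat_exp_commute [of L] by (simp add: L)
  have tri: "L $ 1 $ 2 = 0" "L $ 1 $ 3 = 0" "L $ 2 $ 3 = 0" "L $ 3 $ 3 = L $ 1 $ 1"
    using comm [of 3 2] comm [of 1 1] comm [of 2 1] comm [of 3 1]
    by (simp_all add: matrix_mult_3)
  \<comment> \<open>The (1,2) entry is carried along because it occurs, multiplied by
    \<open>L $ 2 $ 1\<close>, in the recursion for the (2,2) entry.\<close>
  have P: "mat_power L k $ 1 $ 2 = 0 \<and> mat_power L k $ 1 $ 1 = (L $ 1 $ 1) ^ k \<and>
      mat_power L k $ 2 $ 2 = (L $ 2 $ 2) ^ k" for k
    by (induction k) (simp_all add: matrix_mult_3 tri)
  have "mat_exp L $ 1 $ 1 = exp (L $ 1 $ 1)" "mat_exp L $ 2 $ 2 = exp (L $ 2 $ 2)"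
    by (simp_all add: mat_exp_nth P exp_def divide_inverse mult.commute)
  then have diag: "L $ 1 $ 1 = 0" "L $ 2 $ 2 = 0"
    by (simp_all add: L)
  \<comment> \<open>\<open>L\<close> is now strictly lower triangular, so its cube is 0. The (2,1)
    and (3,2) entries of this equation make those entries of \<open>L\<close> vanish; hence the
    quadratic term disappears from the (3,1) entry, which must be 1.\<close>
  have "mat_exp L = mat 1 + L + (1/2) *\<^sub>R (L ** L)"
    by (rule mat_exp_nilpotent) (simp add: vec_eq_iff forall_3 matrix_mult_3 tri diag)
  then show "L = lower 0 0 0 1 0"
    by (auto simp: L vec_eq_iff forall_3 matrix_mult_3 tri diag)
qed

section \<open>The differential of the Cholesky factor\<close>

lemma dir_deriv_eqI:
  assumes "0 < e" "\<And>t. \<bar>t\<bar> < e \<Longrightarrow> f (p + t *\<^sub>R v) = h t" "(h has_vector_derivative d) (at 0)"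
  shows "dir_deriv f p v = d"
  unfolding dir_deriv_def
proof (rule vector_derivative_at)
  show "((\<lambda>t. f (p + t *\<^sub>R v)) has_vector_derivative d) (at 0)"
    by (rule has_vector_derivative_transform_within_open [OF assms(3), where S = "{-e<..<e}"])
       (use assms(1,2) in auto)
qed

lemma has_vector_derivative_lower:
  assumes "(a has_real_derivative a') F" "(b has_real_derivative b') F" "(c has_real_derivative c') F"
    "(p has_real_derivative p') F" "(q has_real_derivative q') F"
  shows "((\<lambda>t. lower (a t) (b t) (c t) (p t) (q t)) has_vector_derivative lower a' b' c' p' q') F"
proof -
  have *: "lower a b c p q = a *\<^sub>R lower 1 0 0 0 0 + b *\<^sub>R lower 0 1 0 0 0 + c *\<^sub>R lower 0 0 1 0 0
      + p *\<^sub>R lower 0 0 0 1 0 + q *\<^sub>R lower 0 0 0 0 1" for a b c p q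
    by (simp add: lower_scale lower_add)
  show ?thesis
    unfolding * [of "a _"] * [of a']
    by (intro has_vector_derivative_add bounded_linear.has_vector_derivative [OF bounded_linear_scaleR_left]
        assms [unfolded has_real_derivative_iff_has_vector_derivative])
qed

text \<open>Entrywise differentiation of the closed form in \<open>chol_factor_symm\<close>:
  \<open>m\<close> is the Schur complement at the base point and \<open>m'\<close> its derivative in
  the given direction.\<close>

lemma dir_deriv_chol_factor:
  assumes a: "0 < a" and b: "0 < b" and m: "0 < m" "m = c - p\<^sup>2 / a - q\<^sup>2 / b"
    and m': "m' = c' - (2 * p * p' / a - p\<^sup>2 * a' / a\<^sup>2) - (2 * q * q' / b - q\<^sup>2 * b' / b\<^sup>2)"
  shows "dir_deriv chol_factor (symm a b c p q) (symm a' b' c' p' q') =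
    lower (a' / (2 * sqrt a)) (b' / (2 * sqrt b)) (m' / (2 * sqrt m))
      (p' / sqrt a - p * a' / (2 * a * sqrt a)) (q' / sqrt b - q * b' / (2 * b * sqrt b))"
proof -
  let ?m = "\<lambda>t. (c + t * c') - (p + t * p')\<^sup>2 / (a + t * a') - (q + t * q')\<^sup>2 / (b + t * b')"
  have "isCont (\<lambda>t. a + t * a') 0" "isCont (\<lambda>t. b + t * b') 0" "isCont ?m 0"
    using a b by (auto intro!: continuous_intros)
  then have lim: "(\<lambda>t. a + t * a') \<midarrow>0\<rightarrow> a" "(\<lambda>t. b + t * b') \<midarrow>0\<rightarrow> b" "?m \<midarrow>0\<rightarrow> m"
    by (simp_all add: isCont_def m(2))
  \<comment> \<open>The closed form holds only where these three quantities are positive; continuity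
    provides a neighbourhood of 0 on which they are.\<close>
  have "\<forall>\<^sub>F t in at 0. 0 < a + t * a' \<and> 0 < b + t * b' \<and> 0 < ?m t"
    by (intro eventually_conj order_tendstoD(1) [OF lim(1)] order_tendstoD(1) [OF lim(2)]
        order_tendstoD(1) [OF lim(3)] a b m(1))
  then obtain e where e: "0 < e"
      "\<And>t. t \<noteq> 0 \<Longrightarrow> \<bar>t\<bar> < e \<Longrightarrow> 0 < a + t * a' \<and> 0 < b + t * b' \<and> 0 < ?m t"
    unfolding eventually_at by (auto simp: dist_real_def)
  have pos: "0 < a + t * a' \<and> 0 < b + t * b' \<and> 0 < ?m t" if "\<bar>t\<bar> < e" for t
    by (cases "t = 0") (use a b m e(2) [OF _ that] in auto)
  have sq: "((\<lambda>t. sqrt (a + t * a')) has_real_derivative a' / (2 * sqrt a)) (at 0)"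
    if "0 < a" for a a' :: real
    using that by (auto intro!: derivative_eq_intros simp: field_simps)
  have quot: "((\<lambda>t. (p + t * p') / sqrt (a + t * a')) has_real_derivative
      p' / sqrt a - p * a' / (2 * a * sqrt a)) (at 0)" if "0 < a" for a a' p p' :: real
    using that by (auto intro!: derivative_eq_intros simp: field_simps)
  have frac: "((\<lambda>t. (p + t * p')\<^sup>2 / (a + t * a')) has_real_derivative
      2 * p * p' / a - p\<^sup>2 * a' / a\<^sup>2) (at 0)" if "0 < a" for a a' p p' :: real
    using that by (auto intro!: derivative_eq_intros simp: field_simps power2_eq_square)
  have "((\<lambda>t. c + t * c') has_real_derivative c') (at 0)"
    by (auto intro!: derivative_eq_intros)
  then have m_deriv: "(?m has_real_derivative m') (at 0)"
    unfolding m' by (intro DERIV_diff frac a b)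
  have sqrt_comp: "((\<lambda>t. sqrt (f t)) has_real_derivative f' / (2 * sqrt (f 0))) (at 0)"
    if "(f has_real_derivative f') (at 0)" "0 < f 0" for f f'
    using DERIV_chain2 [OF DERIV_real_sqrt [OF that(2)] that(1)] by (simp add: field_simps)
  have m0: "?m 0 = m"
    by (simp add: m(2))
  have sqm: "((\<lambda>t. sqrt (?m t)) has_real_derivative m' / (2 * sqrt m)) (at 0)"
    using sqrt_comp [OF m_deriv] m(1) by (simp only: m0)
  show ?thesis
    by (rule dir_deriv_eqI [OF e(1) _ has_vector_derivative_lower [OF sq sq sqm quot quot]])
      (use a b pos in \<open>simp_all add: symm_scale symm_add chol_factor_symm\<close>)
qed

section \<open>Left-invariant metrics and their value at the identity\<close>

lemma riemannian_metricD:
  assumes "riemannian_metric V U g" "p \<in> U"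
  shows "bilinear_on V (g p)"
    and "u \<in> V \<Longrightarrow> v \<in> V \<Longrightarrow> g p u v = g p v u"
    and "u \<in> V \<Longrightarrow> u \<noteq> 0 \<Longrightarrow> 0 < g p u u"
  using assms by (simp_all add: riemannian_metric_def)

lemma left_invariant_metricD:
  assumes "left_invariant_metric g"
  shows "riemannian_metric tri_algebra tri_group g"
    and "S \<in> tri_group \<Longrightarrow> T \<in> tri_group \<Longrightarrow> u \<in> tri_algebra \<Longrightarrow> v \<in> tri_algebra \<Longrightarrow>
      g (S ** T) (S ** u) (S ** v) = g T u v"
  using assms by (simp_all add: left_invariant_metric_def)

lemma mat_1_in_tri_group: "mat 1 \<in> tri_group"
  by (simp add: mat_1_lower)

text \<open>Translation by \<open>T\<close> carries the identity to \<open>T\<close>, so a single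
  inner product on the Lie algebra determines the metric everywhere.\<close>

lemma left_invariant_metric_translate:
  assumes "left_invariant_metric g" "T \<in> tri_group" "u \<in> tri_algebra" "v \<in> tri_algebra"
  shows "g T (T ** u) (T ** v) = g (mat 1) u v"
  using left_invariant_metricD(2) [OF assms(1,2) mat_1_in_tri_group assms(3,4)] by simp

lemmas left_invariant_metric_sym = riemannian_metricD(2) [OF left_invariant_metricD(1)]

lemmas left_invariant_metric_bilinear =
  riemannian_metricD(1) [OF left_invariant_metricD(1) mat_1_in_tri_group]

text \<open>The later computations involve only the span of E_11, E_33 and E_31. Replacing the form
  there by its nine Gram coefficients turns them into scalar calculus with unknown
  constants.\<close>

lemma bilinear_on_lower:
  fixes B :: "real^3^3 \<Rightarrow> real^3^3 \<Rightarrow> real"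
  assumes "bilinear_on tri_algebra B"
  obtains DD DF DN FD FF FN ND NF NN where
    "\<forall>d f n d' f' n'. B (lower d 0 f n 0) (lower d' 0 f' n' 0) =
      d * (d' * DD + f' * DF + n' * DN) + f * (d' * FD + f' * FF + n' * FN)
        + n * (d' * ND + f' * NF + n' * NN)"
proof
  define D F N where DFN: "D = lower 1 0 0 0 0" "F = lower 0 0 1 0 0" "N = lower 0 0 0 1 0"
  have *: "lower d 0 f n 0 = d *\<^sub>R D + f *\<^sub>R F + n *\<^sub>R N" for d f n
    by (simp add: DFN lower_scale lower_add)
  have V: "D \<in> tri_algebra" "F \<in> tri_algebra" "N \<in> tri_algebra"
    "\<And>r. r *\<^sub>R D \<in> tri_algebra" "\<And>r. r *\<^sub>R F \<in> tri_algebra" "\<And>r. r *\<^sub>R N \<in> tri_algebra"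
    "\<And>r s. r *\<^sub>R D + s *\<^sub>R F \<in> tri_algebra" "\<And>r s t. r *\<^sub>R D + s *\<^sub>R F + t *\<^sub>R N \<in> tri_algebra"
    by (simp_all add: DFN lower_scale lower_add)
  have add: "B (u + v) w = B u w + B v w" "B w (u + v) = B w u + B w v"
    if "u \<in> tri_algebra" "v \<in> tri_algebra" "w \<in> tri_algebra" for u v w
    using assms(1) that by (simp_all add: bilinear_on_def)
  have scale: "B (c *\<^sub>R u) v = c * B u v" "B u (c *\<^sub>R v) = c * B u v"
    if "u \<in> tri_algebra" "v \<in> tri_algebra" for u v c
    using assms(1) that by (simp_all add: bilinear_on_def)
  show "\<forall>d f n d' f' n'. B (lower d 0 f n 0) (lower d' 0 f' n' 0) =
    d * (d' * B D D + f' * B D F + n' * B D N) + f * (d' * B F D + f' * B F F + n' * B F N)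
      + n * (d' * B N D + f' * B N F + n' * B N N)"
    unfolding * by (simp add: add scale V) (simp add: algebra_simps)
qed

text \<open>This number is the coefficient \<open>NN\<close>, which the Koszul identity forces to be
  0 in each of the two charts.\<close>

lemma left_invariant_metric_pos:
  assumes "left_invariant_metric g"
  shows "0 < g (mat 1) (lower 0 0 0 1 0) (lower 0 0 0 1 0)"
proof -
  have "lower 0 0 0 1 0 $ 3 $ 1 \<noteq> 0"
    by simp
  then have "lower 0 0 0 1 0 \<noteq> 0"
    by (metis zero_index)
  then show ?thesis
    by (intro riemannian_metricD(3) [OF left_invariant_metricD(1) [OF assms] mat_1_in_tri_group]) simp_all
qed

section \<open>The push-forward metric on the cone\<close>

lemma mat_1_symm: "mat 1 = symm 1 1 1 0 0"
  by (simp add: vec_eq_iff forall_3)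

lemma sym_space_cases:
  assumes "x \<in> sym_space"
  obtains a b c p q where "x = symm a b c p q"
proof
  have x: "x = transpose x" "x $ 1 $ 2 = 0" "x $ 2 $ 1 = 0"
    using assms by (simp_all add: sym_space_def)
  have "x $ 3 $ 1 = x $ 1 $ 3" "x $ 3 $ 2 = x $ 2 $ 3"
    by (subst x(1), simp add: transpose_def)+
  then show "x = symm (x$1$1) (x$2$2) (x$3$3) (x$1$3) (x$2$3)"
    using x(2,3) by (simp add: vec_eq_iff forall_3)
qed

lemma chol_factor_mat_1: "chol_factor (mat 1) = mat 1"
proof -
  have "chol_factor (symm 1 1 1 0 0) = lower 1 1 1 0 0"
    by (simp add: chol_factor_symm)
  then show ?thesis
    by (simp only: mat_1_lower [symmetric] mat_1_symm [symmetric])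
qed

lemma dir_deriv_chol_factor_in_algebra:
  assumes "w \<in> sym_space"
  shows "dir_deriv chol_factor (mat 1) w \<in> tri_algebra"
proof -
  obtain a b c p q where w: "w = symm a b c p q"
    using assms by (rule sym_space_cases)
  have "dir_deriv chol_factor (symm 1 1 1 0 0) (symm a b c p q) \<in> tri_algebra"
    by (subst dir_deriv_chol_factor [of 1 1 1 1 0 0 c c p a q b]) simp_all
  then show ?thesis
    by (simp only: w mat_1_symm)
qed

text \<open>Symmetry of \<open>g\<close> at the identity transfers because the differential of
  \<open>chol_factor\<close> there maps into \<open>tri_algebra\<close>. It supplies the symmetry
  assumption of \<open>levi_civita_koszul\<close>.\<close>

lemma chol_push_metric_sym:
  assumes g: "left_invariant_metric g" and u: "u \<in> sym_space" and v: "v \<in> sym_space"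
  shows "chol_push_metric g (mat 1) u v = chol_push_metric g (mat 1) v u"
  unfolding chol_push_metric_def chol_factor_mat_1
  by (rule left_invariant_metric_sym [OF g mat_1_in_tri_group
        dir_deriv_chol_factor_in_algebra [OF u] dir_deriv_chol_factor_in_algebra [OF v]])

text \<open>The two \<open>lower\<close> matrices are the left-trivialised differentials, T^(-1) dT,
  of the Cholesky factor T on the slice with second diagonal entry 1 and (2,3) entry 0; left
  invariance then moves the base point to the identity.\<close>

lemma chol_push_metric_eq:
  assumes g: "left_invariant_metric g" and a: "0 < a" and m: "0 < m" "m = c - p\<^sup>2 / a"
  shows "chol_push_metric g (symm a 1 c p 0) (symm a' 0 c' p' 0) (symm a'' 0 c'' p'' 0) =
    g (mat 1)
      (lower (a' / (2 * a)) 0 ((c' - (2 * p * p' / a - p\<^sup>2 * a' / a\<^sup>2)) / (2 * m))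
        ((p' - p * a' / a) / (sqrt a * sqrt m)) 0)
      (lower (a'' / (2 * a)) 0 ((c'' - (2 * p * p'' / a - p\<^sup>2 * a'' / a\<^sup>2)) / (2 * m))
        ((p'' - p * a'' / a) / (sqrt a * sqrt m)) 0)"
proof -
  let ?T = "lower (sqrt a) 1 (sqrt m) (p / sqrt a) 0"
  have T: "chol_factor (symm a 1 c p 0) = ?T" "?T \<in> tri_group"
    using a m by (simp_all add: chol_factor_symm)
  \<comment> \<open>Writing dT as a product with \<open>?T\<close> on the left avoids computing an
    inverse matrix and matches the shape of \<open>left_invariant_metric_translate\<close>.\<close>
  have d: "dir_deriv chol_factor (symm a 1 c p 0) (symm a' 0 c' p' 0) =
      ?T ** lower (a' / (2 * a)) 0 ((c' - (2 * p * p' / a - p\<^sup>2 * a' / a\<^sup>2)) / (2 * m))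
        ((p' - p * a' / a) / (sqrt a * sqrt m)) 0" for a' c' p'
  proof -
    have r: "sqrt a * sqrt a = a" "sqrt m * sqrt m = m" "sqrt a \<noteq> 0" "sqrt m \<noteq> 0"
      using a m(1) by simp_all
    have "sqrt a * (a' / (2 * a)) = a' / (2 * sqrt a)"
      "sqrt m * (x / (2 * m)) = x / (2 * sqrt m)" for x
      using r a m(1) by (simp_all add: field_simps)
    moreover have "p / sqrt a * (a' / (2 * a)) + sqrt m * ((p' - p * a' / a) / (sqrt a * sqrt m)) =
        p' / sqrt a - p * a' / (2 * a * sqrt a)"
      using r a by (simp add: field_simps)
    ultimately show ?thesis
      using dir_deriv_chol_factor [OF a zero_less_one, of m c p 0 _ c' p' a' 0 0] m
      by (simp add: lower_mult)
  qed
  show ?thesis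
    unfolding chol_push_metric_def T(1) d
    by (rule left_invariant_metric_translate [OF g T(2)]) simp_all
qed

section \<open>The contradiction on the group and on the cone\<close>

lemma no_invariant_metric_on_group:
  assumes g: "left_invariant_metric g"
    and geo: "geodesic_on tri_algebra tri_group g UNIV (\<lambda>t. mat 1 ** mat_exp (t *\<^sub>R lower 0 0 0 1 0))"
  shows False
proof -
  let ?N = "lower 0 0 0 1 0" and ?D = "lower 1 0 0 0 0" and ?B = "g (mat 1)"
  \<comment> \<open>In the chart of the group the curve is a straight line. The zero quadratic term
    fits it to \<open>quadratic_geodesic\<close>, so the Christoffel term vanishes.\<close>
  have eq: "mat 1 ** mat_exp (t *\<^sub>R ?N) = mat 1 + t *\<^sub>R ?N + t\<^sup>2 *\<^sub>R 0" for t
    unfolding mat_exp_unipotent matrix_mul_lid by (simp add: mat_1_lower lower_scale lower_add)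
  have "geodesic_on tri_algebra tri_group g {0..1} (\<lambda>t. mat 1 + t *\<^sub>R ?N + t\<^sup>2 *\<^sub>R 0)"
    using geodesic_on_subset [OF geo subset_UNIV] unfolding eq .
  then obtain G where G: "levi_civita tri_algebra tri_group g G" "mat 1 \<in> tri_group"
      "G (mat 1) ?N ?N = 0"
    by (rule quadratic_geodesic) simp
  obtain DD DF DN FD FF FN ND NF NN where bil:
    "\<forall>d f n d' f' n'. ?B (lower d 0 f n 0) (lower d' 0 f' n' 0) =
      d * (d' * DD + f' * DF + n' * DN) + f * (d' * FD + f' * FF + n' * FN)
        + n * (d' * ND + f' * NF + n' * NN)"
    by (rule bilinear_on_lower [OF left_invariant_metric_bilinear [OF g]])
  \<comment> \<open>Translating back from I + tN to the identity fixes N and sends D to D - tN; the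
    commutator of N and D enters here.\<close>
  have "dir_deriv (\<lambda>q. g q ?N ?D) (mat 1) ?N = - NN"
  proof (rule dir_deriv_eqI [where e = 1])
    show "g (mat 1 + t *\<^sub>R ?N) ?N ?D = ND - t * NN" for t
    proof -
      have "g (lower 1 1 1 t 0) ?N ?D = ?B ?N (lower 1 0 0 (- t) 0)"
        using left_invariant_metric_translate [OF g, of "lower 1 1 1 t 0" ?N "lower 1 0 0 (- t) 0"]
        by (simp add: lower_mult)
      moreover have "mat 1 + t *\<^sub>R ?N = lower 1 1 1 t 0"
        by (simp add: mat_1_lower lower_scale lower_add)
      ultimately show ?thesis
        by (simp add: bil)
    qed
  qed (auto intro!: derivative_eq_intros)
  \<comment> \<open>Left multiplication by diag(1 + t, 1, 1) fixes N, whose only nonzero row is the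
    third, so the metric coefficient is constant along this line.\<close>
  moreover have "dir_deriv (\<lambda>q. g q ?N ?N) (mat 1) ?D = 0"
  proof (rule dir_deriv_eqI [where e = 1])
    show "g (mat 1 + t *\<^sub>R ?D) ?N ?N = NN" if "\<bar>t\<bar> < 1" for t
    proof -
      have "g (lower (1 + t) 1 1 0 0) ?N ?N = ?B ?N ?N"
        using left_invariant_metric_translate [OF g, of "lower (1 + t) 1 1 0 0" ?N ?N] that
        by (simp add: lower_mult)
      moreover have "mat 1 + t *\<^sub>R ?D = lower (1 + t) 1 1 0 0"
        by (simp add: mat_1_lower lower_scale lower_add)
      ultimately show ?thesis
        by (simp add: bil)
    qed
  qed auto
  moreover have "?B 0 ?D = 0"
    using bil [rule_format, of 0 0 0 1 0 0] by simp
  moreover have "g (mat 1) (G (mat 1) ?N ?N) ?D =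
      dir_deriv (\<lambda>q. g q ?N ?D) (mat 1) ?N - dir_deriv (\<lambda>q. g q ?N ?N) (mat 1) ?D / 2"
    by (rule levi_civita_koszul [OF G(1,2) lower_in_algebra lower_in_algebra])
      (rule left_invariant_metric_sym [OF g G(2)])
  ultimately have "NN = 0"
    by (simp add: G(3))
  then show False
    using left_invariant_metric_pos [OF g] by (simp add: bil)
qed

text \<open>\<open>chol_map\<close> bends the line I + tN into a parabola with acceleration 2 E_33.
  The Koszul identity against E_11 becomes -FD/2 = -FD/2 - NN + NN/2: the unknown \<open>FD\<close>
  cancels and \<open>NN\<close> = 0 remains.\<close>

lemma no_invariant_metric_on_cone:
  assumes g: "left_invariant_metric g"
    and geo: "geodesic_on sym_space pd_cone (chol_push_metric g) {0..1}
      (cholesky_vinberg_path (mat 1) (chol_map (lower 1 1 1 1 0)))"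
  shows False
proof -
  let ?N = "lower 0 0 0 1 0" and ?D = "lower 1 0 0 0 0" and ?F = "lower 0 0 1 0 0"
  let ?B = "g (mat 1)" and ?h = "chol_push_metric g"
  let ?u = "symm 0 0 0 1 0" and ?w = "symm 1 0 0 0 0"
  have fN: "chol_factor (chol_map (lower 1 1 1 1 0)) = lower 1 1 1 1 0"
    unfolding chol_factor_def by (intro inv_into_f_f inj_on_chol_map) simp
  have inv: "matrix_inv (mat 1 :: real^3^3) = mat 1"
    by (simp add: matrix_inv_def)
  have path: "cholesky_vinberg_path (mat 1) (chol_map (lower 1 1 1 1 0)) t =
      mat 1 + t *\<^sub>R ?u + t\<^sup>2 *\<^sub>R symm 0 0 1 0 0" for t
  proof -
    have "cholesky_vinberg_path (mat 1) (chol_map (lower 1 1 1 1 0)) t = chol_map (lower 1 1 1 t 0)"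
      by (simp add: cholesky_vinberg_path_def chol_factor_mat_1 fN inv mat_rpow_def mat_log_unipotent
          mat_exp_unipotent)
    then show ?thesis
      by (simp add: chol_map_lower mat_1_symm symm_add symm_scale)
  qed
  obtain G where G: "levi_civita sym_space pd_cone ?h G" "mat 1 \<in> pd_cone"
      "G (mat 1) ?u ?u = - 2 *\<^sub>R symm 0 0 1 0 0"
    by (rule quadratic_geodesic [OF geodesic_on_cong [OF geo path]])
  obtain DD DF DN FD FF FN ND NF NN where bil:
    "\<forall>d f n d' f' n'. ?B (lower d 0 f n 0) (lower d' 0 f' n' 0) =
      d * (d' * DD + f' * DF + n' * DN) + f * (d' * FD + f' * FF + n' * FN)
        + n * (d' * ND + f' * NF + n' * NN)"
    by (rule bilinear_on_lower [OF left_invariant_metric_bilinear [OF g]])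
  have "dir_deriv (\<lambda>q. ?h q ?u ?w) (mat 1) ?u = - FD / 2 - NN"
  proof (rule dir_deriv_eqI [where e = 1])
    fix t :: real assume "\<bar>t\<bar> < 1"
    define m where "m = 1 - t\<^sup>2"
    \<comment> \<open>The quotient by 1 matches the hypothesis \<open>m = c - p\<^sup>2 / a\<close>
      of \<open>chol_push_metric_eq\<close> at \<open>a = 1\<close>.\<close>
    have m: "0 < m" "m = 1 - t\<^sup>2 / 1"
      using \<open>\<bar>t\<bar> < 1\<close> by (simp_all add: m_def abs_square_less_1)
    have "?h (symm 1 1 1 t 0) ?u ?w =
        ?B (lower 0 0 (- t / m) (1 / sqrt m) 0) (lower (1 / 2) 0 (t\<^sup>2 / (2 * m)) (- t / sqrt m) 0)"
      using chol_push_metric_eq [OF g zero_less_one m, of 0 0 1 1 0 0] by simp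
    moreover have "mat 1 + t *\<^sub>R ?u = symm 1 1 1 t 0"
      by (simp add: mat_1_symm symm_add symm_scale)
    ultimately show "?h (mat 1 + t *\<^sub>R ?u) ?u ?w =
        - t / (1 - t\<^sup>2) * (FD / 2 + t\<^sup>2 / (2 * (1 - t\<^sup>2)) * FF - t / sqrt (1 - t\<^sup>2) * FN)
        + 1 / sqrt (1 - t\<^sup>2) *
          (ND / 2 + t\<^sup>2 / (2 * (1 - t\<^sup>2)) * NF - t / sqrt (1 - t\<^sup>2) * NN)"
      unfolding m_def [symmetric] by (simp add: bil)
  next
    show "((\<lambda>t. - t / (1 - t\<^sup>2) * (FD / 2 + t\<^sup>2 / (2 * (1 - t\<^sup>2)) * FF - t / sqrt (1 - t\<^sup>2) * FN)
        + 1 / sqrt (1 - t\<^sup>2) *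
          (ND / 2 + t\<^sup>2 / (2 * (1 - t\<^sup>2)) * NF - t / sqrt (1 - t\<^sup>2) * NN))
        has_vector_derivative - FD / 2 - NN) (at 0)"
      unfolding has_real_derivative_iff_has_vector_derivative [symmetric]
      by (auto intro!: derivative_eq_intros)
  qed simp
  \<comment> \<open>At diag(1 + t, 1, 1) the Cholesky factor has (1,1) entry sqrt(1 + t), so the
    trivialised image of \<open>?u\<close> is N divided by this root.\<close>
  moreover have "dir_deriv (\<lambda>q. ?h q ?u ?u) (mat 1) ?w = - NN"
  proof (rule dir_deriv_eqI [where e = 1])
    show "?h (mat 1 + t *\<^sub>R ?w) ?u ?u = NN / (1 + t)" if "\<bar>t\<bar> < 1" for t
    proof -
      have "?h (symm (1 + t) 1 1 0 0) ?u ?u =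
          ?B (lower 0 0 0 (1 / sqrt (1 + t)) 0) (lower 0 0 0 (1 / sqrt (1 + t)) 0)"
        using chol_push_metric_eq [OF g, of "1 + t" 1 1 0 0 0 1 0 0 1] that by simp
      moreover have "mat 1 + t *\<^sub>R ?w = symm (1 + t) 1 1 0 0"
        by (simp add: mat_1_symm symm_add symm_scale)
      ultimately show ?thesis
        using that by (simp add: bil)
    qed
    show "((\<lambda>t. NN / (1 + t)) has_vector_derivative - NN) (at 0)"
      unfolding has_real_derivative_iff_has_vector_derivative [symmetric]
      by (auto intro!: derivative_eq_intros)
  qed simp
  \<comment> \<open>At the identity the differential of \<open>chol_factor\<close> halves diagonal
    directions: -2 E_33 becomes -E_33 and E_11 becomes E_11 / 2.\<close>
  moreover have "?h (mat 1) (symm 0 0 (- 2) 0 0) ?w = - FD / 2"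
    using chol_push_metric_eq [OF g, of 1 1 1 0 0 "-2" 0 1 0 0]
    by (simp add: mat_1_symm [symmetric] bil)
  moreover have "G (mat 1) ?u ?u = symm 0 0 (- 2) 0 0"
    unfolding G(3) by (simp add: vec_eq_iff forall_3)
  moreover have "?h (mat 1) (G (mat 1) ?u ?u) ?w =
      dir_deriv (\<lambda>q. ?h q ?u ?w) (mat 1) ?u - dir_deriv (\<lambda>q. ?h q ?u ?u) (mat 1) ?w / 2"
    by (rule levi_civita_koszul [OF G(1,2) symm_in_space symm_in_space])
      (rule chol_push_metric_sym [OF g])
  ultimately have "NN = 0"
    by simp
  then show False
    using left_invariant_metric_pos [OF g] by (simp add: bil)
qed

theorem proposition6p10:
  shows "(\<nexists>g. left_invariant_metric g \<and>
            (\<forall>S\<in>tri_group. \<forall>A\<in>tri_algebra.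
               geodesic_on tri_algebra tri_group g UNIV (\<lambda>t. S ** mat_exp (t *\<^sub>R A)))) \<and>
         (\<nexists>g. left_invariant_metric g \<and>
            (\<forall>x\<in>pd_cone. \<forall>y\<in>pd_cone.
               geodesic_on sym_space pd_cone (chol_push_metric g) {0..1}
                 (cholesky_vinberg_path x y)))"
proof -
  \<comment> \<open>The endpoints of the test path must lie in the cone before the assumption on all
    paths can be applied to it.\<close>
  have 1: "mat 1 \<in> pd_cone"
    using chol_map_in_pd_cone [OF mat_1_in_tri_group] by (simp add: chol_map_def transpose_mat)
  have 2: "chol_map (lower 1 1 1 1 0) \<in> pd_cone"
    by (simp add: chol_map_in_pd_cone)
  show ?thesis
  proof (intro conjI notI; elim exE conjE)
    fix g assume "left_invariant_metric g" "\<forall>S\<in>tri_group. \<forall>A\<in>tri_algebra.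
      geodesic_on tri_algebra tri_group g UNIV (\<lambda>t. S ** mat_exp (t *\<^sub>R A))"
    then show False
      by (metis no_invariant_metric_on_group mat_1_in_tri_group lower_in_algebra)
  next
    fix g assume "left_invariant_metric g" "\<forall>x\<in>pd_cone. \<forall>y\<in>pd_cone.
      geodesic_on sym_space pd_cone (chol_push_metric g) {0..1} (cholesky_vinberg_path x y)"
    then show False
      using no_invariant_metric_on_cone 1 2 by blast
  qed
qed

end
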